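(* Let $\mathbf{q}=(q_1,\dots,q_n)$ be a list of positive integers. Then there exists a cyclically ordered $E=(\theta_1,\dots,\theta_n)$ with $\theta_i\in\mathbb{R}/2\pi\mathbb{Z}$ and charges $\mathbf{q}$ such that $E$ is a critical point of $\mu$, i.e. $E$ is in equilibrium for the charged trigonometric Calogero-Moser potential. Furthermore, this $E$ is unique up to simultaneous rotation: if $E=(\theta_1,\dots,\theta_n)$ and $E'=(\theta'_1,\dots,\theta'_n)$ are two such, then there is $c\in\mathbb{R}/2\pi\mathbb{Z}$ with $\theta'_i=\theta_i+c$ for all $i$.
   Context: For fixed charges $\mathbf{q}=(q_1,\dots,q_n)$, the charged trigonometric Calogero-Moser potential of a tuple $E=(\theta_1,\dots,\theta_n)$ of distinct points is $$\mu(E)=\sum_{i\neq j}\frac{q_iq_j}{\sin^2\left(\frac{\theta_j-\theta_i}{2}\right)},$$ the sum being over ordered pairs $1\le i,j\le n$ with $i\ne j$. $E$ is a critical point of $\mu$ (equivalently, in equilibrium) if $\frac{\partial\mu}{\partial\theta_i}(E)=0$ for all $i$. A tuple $(\theta_1,\dots,\theta_n)$ in $\mathbb{R}/2\pi\mathbb{Z}$ is cyclically ordered if, with representatives of the $\theta_i$ in $[0,2\pi)$, there is some $i$ with $\theta_i<\theta_{i+1}<\dots<\theta_n<\theta_1<\dots<\theta_{i-1}$. *)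

theory Defs
  imports Complex_Main "HOL-Library.Real_Mod"
begin

text \<open>
  A point of \<open>\<real>/2\<pi>\<int>\<close> is given by a real number, two reals being the same point iff they are
  congruent modulo \<open>2\<pi>\<close>; \<open>x rmod (2 * pi)\<close> is the representative in \<open>[0, 2\<pi>)\<close>.
  All notions below depend only on the entries of \<open>\<theta>\<close> modulo \<open>2\<pi>\<close>. Lists are indexed from 0.
\<close>

definition angle_reps :: "real list \<Rightarrow> real list" where
  "angle_reps \<theta> = map (\<lambda>x. x rmod (2 * pi)) \<theta>"

text \<open>
  \<open>rotate k\<close> turns \<open>(\<theta>\<^sub>1, \<dots>, \<theta>\<^sub>n)\<close> into \<open>(\<theta>\<^sub>i, \<dots>, \<theta>\<^sub>n, \<theta>\<^sub>1, \<dots>, \<theta>\<^bsub>i-1\<^esub>)\<close> with \<open>i = k mod n + 1\<close>.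
\<close>
definition cyclically_ordered :: "real list \<Rightarrow> bool" where
  "cyclically_ordered \<theta> \<longleftrightarrow> (\<exists>k. sorted_wrt (<) (rotate k (angle_reps \<theta>)))"

definition cm_potential :: "int list \<Rightarrow> real list \<Rightarrow> real" where
  "cm_potential q \<theta> =
     (\<Sum>(i, j) \<in> {(i, j). i < length q \<and> j < length q \<and> i \<noteq> j}.
        of_int (q ! i) * of_int (q ! j) / (sin ((\<theta> ! j - \<theta> ! i) / 2))\<^sup>2)"

text \<open>
  Distinctness is required because the potential is meaningful only for distinct points; at a
  collision the formula would silently evaluate the singular terms to \<open>0\<close>.
\<close>
definition in_equilibrium :: "int list \<Rightarrow> real list \<Rightarrow> bool" where
  "in_equilibrium q \<theta> \<longleftrightarrow>
     length \<theta> = length q \<and> distinct (angle_reps \<theta>) \<and>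
     (\<forall>i < length q.
        ((\<lambda>t. cm_potential q (\<theta>[i := t])) has_real_derivative 0) (at (\<theta> ! i)))"

end

theory Submission
  imports Defs "HOL-Analysis.Function_Metric"
begin

text \<open>
  Cut the circle open: a cyclically ordered tuple lifts to reals
  \<open>x\<^sub>1 < \<dots> < x\<^sub>n < x\<^sub>1 + 2\<pi>\<close>. Every pair contributes \<open>1 / sin\<^sup>2 \<ge> 0\<close> with weight at least 1, and
  this term blows up when the two points collide, so the sublevel sets of \<open>\<mu>\<close> modulo rotation are
  compact and a minimiser exists; it is interior, hence critical.

  Uniqueness is a maximum principle. The force between two points at distance \<open>u\<close> is strictly
  decreasing in \<open>u \<in> (0, 2\<pi>)\<close>. If \<open>x\<close> and \<open>y\<close> are equilibria and \<open>y\<^sub>i - x\<^sub>i\<close> is maximal among all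
  indices, then every force on point \<open>i\<close> is at least as large for \<open>y\<close> as for \<open>x\<close>; as both
  totals vanish, all these forces agree, and so \<open>y\<^sub>j - x\<^sub>j = y\<^sub>i - x\<^sub>i\<close> for all \<open>j\<close>.
\<close>

section \<open>Forces and lifted configurations\<close>

text \<open>Minus half the derivative of \<open>1 / (sin (u / 2))\<^sup>2 = 2 / (1 - cos u)\<close>;
  this form is visibly odd and 2 pi-periodic.\<close>

definition pair_force :: "real \<Rightarrow> real" where
  "pair_force u = sin u / (1 - cos u)\<^sup>2"

definition potential :: "int list \<Rightarrow> (nat \<Rightarrow> real) \<Rightarrow> real" where
  "potential q x = (\<Sum>(i, j) \<in> Sigma {..<length q} (\<lambda>i. {..<length q} - {i}).
     of_int (q ! i) * of_int (q ! j) * (2 / (1 - cos (x j - x i))))"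

text \<open>The common factor \<open>q ! i\<close> is left out; \<open>4 * q ! i\<close> times this
  is the partial derivative of \<open>potential\<close>.\<close>

definition total_force :: "int list \<Rightarrow> (nat \<Rightarrow> real) \<Rightarrow> nat \<Rightarrow> real" where
  "total_force q x i = (\<Sum>j\<in>{..<length q} - {i}. of_int (q ! j) * pair_force (x j - x i))"

text \<open>Functions rather than lists, so that minimisation takes place in a product space; values
  at indices from \<open>n\<close> on are free.\<close>

definition ordered_configs :: "nat \<Rightarrow> (nat \<Rightarrow> real) set" where
  "ordered_configs n = {x. \<forall>i j. i < j \<longrightarrow> j < n \<longrightarrow> x i < x j \<and> x j < x i + 2 * pi}"

lemma ordered_configsD:
  assumes "x \<in> ordered_configs n" "i < j" "j < n"
  shows "x i < x j" "x j < x i + 2 * pi"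
  using assms by (auto simp: ordered_configs_def)

lemma cos_lt_one:
  fixes u :: real
  assumes "0 < u" "u < 2 * pi"
  shows "cos u < 1"
proof -
  have "0 < sin (u / 2)"
    using assms by (intro sin_gt_zero) auto
  moreover have "cos u = 1 - 2 * (sin (u / 2))\<^sup>2"
    using cos_double_sin[of "u / 2"] by simp
  ultimately show ?thesis by simp
qed

lemma cos_lt_one_ordered_configs:
  assumes "x \<in> ordered_configs n" "i < n" "j < n" "i \<noteq> j"
  shows "cos (x j - x i) < 1"
proof (cases "i < j")
  case True
  then show ?thesis
    using assms ordered_configsD[of x n i j] by (intro cos_lt_one) auto
next
  case False
  then have "cos (x i - x j) < 1"
    using assms ordered_configsD[of x n j i] by (intro cos_lt_one) auto
  then show ?thesis
    by (metis cos_minus minus_diff_eq)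
qed

section \<open>The potential and its partial derivatives\<close>

text \<open>Half-angle formula. The terms agree at collisions too, where division by zero makes both
  of them 0.\<close>

lemma cm_potential_eq: "cm_potential q \<theta> = potential q ((!) \<theta>)"
proof -
  have "{(i, j). i < length q \<and> j < length q \<and> i \<noteq> j}
      = Sigma {..<length q} (\<lambda>i. {..<length q} - {i})"
    by auto
  moreover have "c / (sin (u / 2))\<^sup>2 = c * (2 / (1 - cos u))" for c u :: real
    using cos_double_sin[of "u / 2"] by simp
  ultimately show ?thesis
    by (simp only: cm_potential_def potential_def)
qed

lemma potential_cong:
  assumes "\<And>i j. i < length q \<Longrightarrow> j < length q \<Longrightarrow> x j - x i = y j - y i"
  shows "potential q x = potential q y"
  unfolding potential_def using assms by (intro sum.cong) auto

lemma cm_potential_update: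
  assumes "\<And>j. j < length q \<Longrightarrow> \<theta> ! j = x j" "length \<theta> = length q"
  shows "cm_potential q (\<theta>[i := t]) = potential q (x(i := t))"
  unfolding cm_potential_eq using assms
  by (intro potential_cong) (auto simp: nth_list_update)

text \<open>The 4 is 2 * 2: each pair containing \<open>i\<close> occurs in both orders, and
  \<open>pair_force\<close> carries half of the derivative.\<close>

lemma has_real_derivative_potential:
  assumes i: "i < length q"
    and ne: "\<And>j. j < length q \<Longrightarrow> j \<noteq> i \<Longrightarrow> cos (x j - x i) \<noteq> 1"
  shows "((\<lambda>t. potential q (x(i := t))) has_real_derivative
           4 * of_int (q ! i) * total_force q x i) (at (x i))"
proof -
  define n where "n = length q"
  define A where "A j = 2 * of_int (q ! i) * (of_int (q ! j) * pair_force (x j - x i))" for j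
  let ?S = "Sigma {..<n} (\<lambda>a. {..<n} - {a})"
  have term_deriv: "((\<lambda>t. of_int (q ! a) * of_int (q ! b) *
          (2 / (1 - cos ((x(i := t)) b - (x(i := t)) a)))) has_real_derivative
        (if a = i then A b else 0) + (if b = i then A a else 0)) (at (x i))"
    if ab: "a < n" "b < n" "a \<noteq> b" for a b
  proof -
    consider "a = i" "b \<noteq> i" | "a \<noteq> i" "b = i" | "a \<noteq> i" "b \<noteq> i"
      using ab by blast
    then show ?thesis
    proof cases
      case 1
      then have "1 - cos (x b - x i) \<noteq> 0"
        using ne[of b] ab by (simp add: n_def)
      with 1 show ?thesis
        by (auto intro!: derivative_eq_intros simp: A_def pair_force_def power2_eq_square)
    next
      case 2
      \<comment> \<open>Since \<open>pair_force\<close> is odd, a pair with \<open>i\<close> in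
        second place contributes the same as its mirror image.\<close>
      have flip: "cos (x i - x a) = cos (x a - x i)" "sin (x i - x a) = - sin (x a - x i)"
        by (metis cos_minus minus_diff_eq, metis sin_minus minus_diff_eq)
      have "1 - cos (x a - x i) \<noteq> 0"
        using ne[of a] ab 2 by (simp add: n_def)
      with 2 flip show ?thesis
        by (auto intro!: derivative_eq_intros simp: A_def pair_force_def power2_eq_square)
    qed auto
  qed
  have "((\<lambda>t. potential q (x(i := t))) has_real_derivative
      (\<Sum>(a, b)\<in>?S. (if a = i then A b else 0) + (if b = i then A a else 0))) (at (x i))"
    unfolding potential_def n_def[symmetric] case_prod_beta
    by (intro DERIV_sum term_deriv) auto
  also have "(\<Sum>(a, b)\<in>?S. (if a = i then A b else 0) + (if b = i then A a else 0))
      = (\<Sum>(a, b)\<in>?S. if a = i then A b else 0) + (\<Sum>(a, b)\<in>?S. if b = i then A a else 0)"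
    by (simp add: case_prod_beta sum.distrib)
  also have "(\<Sum>(a, b)\<in>?S. if b = i then A a else 0) = (\<Sum>(a, b)\<in>?S. if a = i then A b else 0)"
    by (rule sum.reindex_bij_witness[of _ prod.swap prod.swap]) auto
  also have "(\<Sum>(a, b)\<in>?S. if a = i then A b else 0) = (\<Sum>b\<in>{..<n} - {i}. A b)"
  proof -
    have "(\<Sum>(a, b)\<in>?S. if a = i then A b else 0)
        = (\<Sum>a<n. \<Sum>b\<in>{..<n} - {a}. if a = i then A b else 0)"
      by (subst sum.Sigma) auto
    also have "\<dots> = (\<Sum>a<n. if a = i then \<Sum>b\<in>{..<n} - {i}. A b else 0)"
      by (intro sum.cong) auto
    finally show ?thesis
      using i by (simp add: n_def)
  qed
  finally show ?thesis
    by (simp add: A_def total_force_def n_def mult.assoc fun_upd_def flip: sum_distrib_left)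
qed

section \<open>Monotone forces and uniqueness up to translation\<close>

text \<open>The derivative simplifies to \<open>- (cos w + 2) / (1 - cos w)\<^sup>2\<close>, which
  is negative wherever \<open>cos w < 1\<close>.\<close>

lemma pair_force_strict_antimono:
  assumes "0 < u" "u < v" "v < 2 * pi"
  shows "pair_force v < pair_force u"
proof (rule DERIV_neg_imp_decreasing[OF assms(2)])
  fix w
  assume "u \<le> w" "w \<le> v"
  then have c: "1 - cos w > 0"
    using assms cos_lt_one[of w] by simp
  have deriv: "(pair_force has_real_derivative
      (cos w * (1 - cos w)\<^sup>2 - sin w * (2 * (1 - cos w) * sin w)) / ((1 - cos w)\<^sup>2 * (1 - cos w)\<^sup>2))
      (at w)"
    unfolding pair_force_def using c by (auto intro!: derivative_eq_intros)
  have "cos w * (1 - cos w)\<^sup>2 - sin w * (2 * (1 - cos w) * sin w)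
      = - ((1 - cos w)\<^sup>2 * (cos w + 2))"
  proof -
    have "sin w * sin w = 1 - cos w * cos w"
      using sin_squared_eq[of w] by (simp add: power2_eq_square)
    then show ?thesis by algebra
  qed
  moreover have "cos w + 2 > 0"
    using cos_ge_minus_one[of w] by linarith
  ultimately have "(cos w * (1 - cos w)\<^sup>2 - sin w * (2 * (1 - cos w) * sin w))
      / ((1 - cos w)\<^sup>2 * (1 - cos w)\<^sup>2) < 0"
    using c by (simp add: divide_neg_pos)
  with deriv show "\<exists>y. (pair_force has_real_derivative y) (at w) \<and> y < 0"
    by blast
qed

lemma pair_force_add_2pi [simp]: "pair_force (u + 2 * pi) = pair_force u"
  by (simp add: pair_force_def)

lemma ordered_configs_equilibrium_unique:
  assumes q: "\<And>i. i < length q \<Longrightarrow> q ! i > 0"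
    and x: "x \<in> ordered_configs (length q)" "\<And>i. i < length q \<Longrightarrow> total_force q x i = 0"
    and y: "y \<in> ordered_configs (length q)" "\<And>i. i < length q \<Longrightarrow> total_force q y i = 0"
  shows "\<exists>c. \<forall>i < length q. y i = x i + c"
proof (cases "length q = 0")
  case False
  define n where "n = length q"
  obtain i where i: "i < n" and max: "\<And>j. j < n \<Longrightarrow> y j - x j \<le> y i - x i"
  proof -
    have "Max ((\<lambda>i. y i - x i) ` {..<n}) \<in> (\<lambda>i. y i - x i) ` {..<n}"
      using False by (intro Max_in) (auto simp: n_def)
    then obtain i where "i < n" and "Max ((\<lambda>i. y i - x i) ` {..<n}) = y i - x i"
      by auto
    moreover have "y j - x j \<le> Max ((\<lambda>i. y i - x i) ` {..<n})" if "j < n" for j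
      using that by (intro Max_ge) auto
    ultimately show ?thesis
      using that by simp
  qed
  \<comment> \<open>By the choice of \<open>i\<close>, \<open>y j - y i \<le> x j - x i\<close>:
    seen from \<open>i\<close>, passing from \<open>x\<close> to \<open>y\<close> increases no
    difference.\<close>
  have force: "pair_force (x j - x i) \<le> pair_force (y j - y i)"
    "pair_force (x j - x i) = pair_force (y j - y i) \<Longrightarrow> y j - x j = y i - x i"
    if j: "j < n" "j \<noteq> i" for j
  proof -
    \<comment> \<open>For \<open>j < i\<close> the difference is negative; a full turn brings it
      into (0, 2 pi), where \<open>pair_force\<close> is monotone, and leaves the force
      unchanged.\<close>
    define s where "s = (if i < j then 0 else 2 * pi)"
    have "0 < y j - y i + s" "y j - y i + s \<le> x j - x i + s" "x j - x i + s < 2 * pi"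
    proof (atomize (full), cases "i < j")
      case True
      then show "0 < y j - y i + s \<and> y j - y i + s \<le> x j - x i + s \<and> x j - x i + s < 2 * pi"
        using j max[of j] ordered_configsD[OF x(1), of i j] ordered_configsD[OF y(1), of i j]
        by (simp add: s_def n_def)
    next
      case False
      with j have "j < i" by simp
      then show "0 < y j - y i + s \<and> y j - y i + s \<le> x j - x i + s \<and> x j - x i + s < 2 * pi"
        using i max[of j] j ordered_configsD[OF x(1), of j i] ordered_configsD[OF y(1), of j i]
        by (simp add: s_def n_def)
    qed
    then have "y j - y i = x j - x i \<or>
        pair_force (x j - x i + s) < pair_force (y j - y i + s)"
      using pair_force_strict_antimono[of "y j - y i + s" "x j - x i + s"] by linarith
    moreover have "pair_force (u + s) = pair_force u" for u
      by (simp add: s_def)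
    ultimately show "pair_force (x j - x i) \<le> pair_force (y j - y i)"
      "pair_force (x j - x i) = pair_force (y j - y i) \<Longrightarrow> y j - x j = y i - x i"
      by auto
  qed
  have "(\<Sum>j\<in>{..<n} - {i}. of_int (q ! j) * (pair_force (y j - y i) - pair_force (x j - x i))) = 0"
    using x(2)[of i] y(2)[of i] i
    by (simp add: total_force_def n_def right_diff_distrib sum_subtractf)
  \<comment> \<open>Nonnegative terms with sum 0 all vanish; as the charges are positive, the forces
    themselves then agree.\<close>
  then have "\<forall>j\<in>{..<n} - {i}. of_int (q ! j) * (pair_force (y j - y i) - pair_force (x j - x i)) = 0"
    using q force(1) by (subst (asm) sum_nonneg_eq_0_iff) (auto simp: n_def less_imp_le)
  then have "y j - x j = y i - x i" if "j < n" for j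
    using that force(2)[of j] q[of j] by (cases "j = i") (auto simp: n_def dest!: bspec[of _ _ j])
  then show ?thesis
    by (intro exI[of _ "y i - x i"]) (simp add: n_def algebra_simps)
qed auto

section \<open>Lifting from the circle to the line\<close>

text \<open>The representatives in [0, 2 pi) increase with the index except for at most one drop,
  just before index \<open>k\<close>. Adding 2 pi from \<open>k\<close> on removes the drop.\<close>

lemma cyclically_ordered_lift:
  assumes "cyclically_ordered \<theta>"
  obtains x where "x \<in> ordered_configs (length \<theta>)"
    "\<And>i. i < length \<theta> \<Longrightarrow> [x i = \<theta> ! i] (rmod (2 * pi))"
proof (cases "\<theta> = []")
  case True
  then show ?thesis
    by (intro that) (auto simp: ordered_configs_def)
next
  case False
  define n where "n = length \<theta>"
  define r where "r i = \<theta> ! i rmod (2 * pi)" for i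
  have r: "0 \<le> r i" "r i < 2 * pi" for i
    by (simp_all add: r_def rmod_nonneg rmod_less)
  obtain k0 where "sorted_wrt (<) (rotate k0 (angle_reps \<theta>))"
    using assms by (auto simp: cyclically_ordered_def)
  moreover define k where "k = k0 mod n"
  ultimately have "sorted_wrt (<) (rotate k (angle_reps \<theta>))"
    using rotate_conv_mod[of k0 "angle_reps \<theta>"] by (simp add: n_def angle_reps_def)
  moreover have "rotate k (angle_reps \<theta>) ! a = r ((k + a) mod n)" if "a < n" for a
    using that False by (simp add: nth_rotate angle_reps_def n_def r_def)
  ultimately have sorted: "r ((k + a) mod n) < r ((k + b) mod n)" if "a < b" "b < n" for a b
    using that by (fastforce simp: sorted_wrt_iff_nth_less angle_reps_def n_def)
  have k: "k < n"
    using False by (simp add: k_def n_def)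
  \<comment> \<open>In the rotated list, an index \<open>i < k\<close> sits at position
    \<open>n - k + i\<close> and an index \<open>i \<ge> k\<close> at position \<open>i - k\<close>;
    so the latter come first.\<close>
  have low: "r i < r j" if "i < j" "j < k" for i j
    using sorted[of "n - k + i" "n - k + j"] that k by simp
  have high: "r i < r j" if "k \<le> i" "i < j" "j < n" for i j
    using sorted[of "i - k" "j - k"] that k by simp
  have across: "r j < r i" if "i < k" "k \<le> j" "j < n" for i j
    using sorted[of "j - k" "n - k + i"] that k by simp
  define x where "x i = (if i < k then r i else r i + 2 * pi)" for i
  show ?thesis
  proof (rule that)
    have "x i < x j \<and> x j < x i + 2 * pi" if "i < j" "j < n" for i j
      using that low[of i j] high[of i j] across[of i j] r[of i] r[of j] by (auto simp: x_def)
    then show "x \<in> ordered_configs (length \<theta>)"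
      by (auto simp: ordered_configs_def n_def)
    fix i
    have "[r i = \<theta> ! i] (rmod (2 * pi))"
      by (simp add: r_def rcong_def)
    moreover from this have "[r i + 2 * pi = \<theta> ! i + 0] (rmod (2 * pi))"
      by (intro rcong_add) (simp_all add: rcong_def)
    ultimately show "[x i = \<theta> ! i] (rmod (2 * pi))"
      by (simp add: x_def)
  qed
qed

lemma sin_cos_diff_rcong:
  assumes "[a = a'] (rmod (2 * pi))" "[b = b'] (rmod (2 * pi))"
  shows "sin (a - b) = sin (a' - b')" "cos (a - b) = cos (a' - b')"
proof -
  have "cis (a - b) = cis (a' - b')"
    using rcong_diff[OF assms] by (rule cis_cong)
  then show "sin (a - b) = sin (a' - b')" "cos (a - b) = cos (a' - b')"
    by (simp_all add: cis.ctr)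
qed

text \<open>The computed derivative must equal the prescribed 0, and the force depends only on the
  points of the circle, so it may be evaluated at the lift.\<close>

lemma in_equilibrium_imp_total_force_eq_0:
  assumes q: "\<And>i. i < length q \<Longrightarrow> q ! i > 0"
    and eq: "in_equilibrium q \<theta>"
    and x: "x \<in> ordered_configs (length q)"
    and cong: "\<And>i. i < length q \<Longrightarrow> [x i = \<theta> ! i] (rmod (2 * pi))"
    and i: "i < length q"
  shows "total_force q x i = 0"
proof -
  \<comment> \<open>The lift has the same cosines of differences, and there they are below
    1.\<close>
  have ne: "cos (\<theta> ! j - \<theta> ! i) \<noteq> 1" if "j < length q" "j \<noteq> i" for j
    using cos_lt_one_ordered_configs[OF x i that(1)] that
      sin_cos_diff_rcong(2)[OF cong[OF that(1)] cong[OF i]] by simp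
  have "((\<lambda>t. cm_potential q (\<theta>[i := t])) has_real_derivative 0) (at (\<theta> ! i))"
    using eq i by (simp add: in_equilibrium_def)
  moreover have "cm_potential q (\<theta>[i := t]) = potential q (((!) \<theta>)(i := t))" for t
    using eq by (intro cm_potential_update) (simp_all add: in_equilibrium_def)
  ultimately have "((\<lambda>t. potential q (((!) \<theta>)(i := t))) has_real_derivative 0) (at (\<theta> ! i))"
    by simp
  then have "4 * of_int (q ! i) * total_force q ((!) \<theta>) i = 0"
    using has_real_derivative_potential[OF i, of "(!) \<theta>"] ne by (intro DERIV_unique) auto
  then have "total_force q ((!) \<theta>) i = 0"
    using q[OF i] by simp
  moreover have "total_force q x i = total_force q ((!) \<theta>) i"
    unfolding total_force_def pair_force_def
    using sin_cos_diff_rcong[OF cong cong[OF i]] by (intro sum.cong) auto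
  ultimately show ?thesis by simp
qed

section \<open>Existence by minimising the potential\<close>

text \<open>Positive integer charges give every pair weight at least 1. A bound on the potential
  thus keeps all pairs of points apart.\<close>

lemma pair_term_le_potential:
  assumes q: "\<And>i. i < length q \<Longrightarrow> q ! i > 0"
    and ij: "i < length q" "j < length q" "i \<noteq> j"
  shows "2 / (1 - cos (x j - x i)) \<le> potential q x"
proof -
  have "0 < q ! i * q ! j"
    using q[OF ij(1)] q[OF ij(2)] by simp
  then have "1 \<le> q ! i * q ! j"
    by simp
  then have "1 \<le> real_of_int (q ! i) * real_of_int (q ! j)"
    by (metis of_int_1_le_iff of_int_mult)
  then have "1 * (2 / (1 - cos (x j - x i)))
      \<le> of_int (q ! i) * of_int (q ! j) * (2 / (1 - cos (x j - x i)))"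
    by (rule mult_right_mono) simp
  also have "\<dots> \<le> potential q x"
    unfolding potential_def
    using member_le_sum[of "(i, j)" "Sigma {..<length q} (\<lambda>i. {..<length q} - {i})"
        "\<lambda>(i, j). of_int (q ! i) * of_int (q ! j) * (2 / (1 - cos (x j - x i)))"] q ij
    by (auto simp: less_imp_le)
  finally show ?thesis by simp
qed

text \<open>Tychonoff's theorem for the product topology on functions.\<close>

lemma compact_function_box:
  fixes B :: "'a \<Rightarrow> 'b::topological_space set"
  assumes "\<And>i. compact (B i)"
  shows "compact (PiE UNIV B)"
  using assms compactin_PiE[of "\<lambda>_. euclidean" UNIV B]
  by (simp add: euclidean_product_topology)

text \<open>After normalisation, the configurations of potential at most \<open>M\<close> lie in a
  compact set \<open>K\<close> on which the potential is continuous. Those above \<open>M\<close>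
  lose to the equally spaced \<open>e\<close>.\<close>

lemma potential_minimiser:
  assumes q: "\<And>i. i < length q \<Longrightarrow> q ! i > 0"
  obtains x where "x \<in> ordered_configs (length q)" "x 0 = 0"
    "\<And>y. y \<in> ordered_configs (length q) \<Longrightarrow> potential q x \<le> potential q y"
proof -
  define n where "n = length q"
  define e where "e i = (if i < n then 2 * pi * real i / real n else 0)" for i
  have e: "e \<in> ordered_configs n"
  proof -
    have "e i < e j \<and> e j < e i + 2 * pi" if "i < j" "j < n" for i j
    proof -
      have "real j - real i < real n" using that by linarith
      then have "2 * pi * (real j - real i) < 2 * pi * real n" by simp
      then show ?thesis using that by (simp add: e_def field_simps)
    qed
    then show ?thesis by (simp add: ordered_configs_def)
  qed
  have e0: "e 0 = 0" by (simp add: e_def)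
  have nonneg: "0 \<le> potential q x" for x
    unfolding potential_def using q by (intro sum_nonneg) (auto simp: less_imp_le)
  \<comment> \<open>The \<open>+ 1\<close> keeps \<open>M\<close> positive also when there are fewer than two points.\<close>
  define M where "M = potential q e + 1"
  have M: "M > 0"
    using nonneg[of e] by (simp add: M_def)
  \<comment> \<open>Fixing coordinate 0 removes the rotations; fixing those from \<open>n\<close> on
    makes the box compact in the space of all functions on \<open>nat\<close>.\<close>
  define box where "box = PiE UNIV (\<lambda>i. if i \<noteq> 0 \<and> i < n then {0..2 * pi} else {0})"
  \<comment> \<open>Weak inequalities make \<open>K\<close> closed. The bound \<open>2 / M\<close>
    is what \<open>potential q x \<le> M\<close> yields for a single pair; it takes over the role of
    strictness.\<close>
  define K where "K = box \<inter> (\<Inter>p\<in>{(i, j). i < j \<and> j < n}.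
    {x. x (fst p) \<le> x (snd p)} \<inter> {x. x (snd p) \<le> x (fst p) + 2 * pi} \<inter>
    {x. 2 / M \<le> 1 - cos (x (snd p) - x (fst p))})"
  have K_pair: "x i \<le> x j" "x j \<le> x i + 2 * pi" "cos (x j - x i) \<noteq> 1"
    if "x \<in> K" "i < j" "j < n" for x i j
  proof -
    have pair: "x i \<le> x j \<and> x j \<le> x i + 2 * pi \<and> 2 / M \<le> 1 - cos (x j - x i)"
      using that by (auto simp: K_def)
    moreover have "2 / M > 0"
      using M by simp
    ultimately show "x i \<le> x j" "x j \<le> x i + 2 * pi" "cos (x j - x i) \<noteq> 1"
      by auto
  qed
  have cont: "continuous_on UNIV (\<lambda>x::nat \<Rightarrow> real. x i)" for i
    by simp
  have "compact box"
    unfolding box_def by (rule compact_function_box) auto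
  then have "compact K"
    unfolding K_def by (intro compact_Int_closed closed_INT ballI closed_Int closed_Collect_le
        continuous_intros cont)
  moreover have mem_K: "x \<in> K"
    if x: "x \<in> ordered_configs n" "x 0 = 0" "\<And>i. i \<ge> n \<Longrightarrow> x i = 0" and le: "potential q x \<le> M" for x
  proof -
    have "x i \<in> (if i \<noteq> 0 \<and> i < n then {0..2 * pi} else {0})" for i
      using x ordered_configsD[of x n 0 i] by auto
    moreover have "2 / M \<le> 1 - cos (x j - x i)" if "i < j" "j < n" for i j
    proof -
      have "2 / (1 - cos (x j - x i)) \<le> M"
        using pair_term_le_potential[OF q, where x = x and i = i and j = j] that le
        by (simp add: n_def)
      moreover have "1 - cos (x j - x i) > 0"
        using cos_lt_one_ordered_configs[OF x(1), of i j] that by simp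
      ultimately show ?thesis
        using M by (simp add: field_simps)
    qed
    ultimately show ?thesis
      using ordered_configsD[OF x(1)] by (auto simp: K_def box_def less_imp_le)
  qed
  have eK: "e \<in> K"
    using e e0 by (intro mem_K) (auto simp: M_def e_def)
  moreover have "continuous_on K (potential q)"
  proof -
    have "cos (x j - x i) \<noteq> 1" if "x \<in> K" "i < n" "j < n" "i \<noteq> j" for x i j
    proof (cases "i < j")
      case False
      then show ?thesis
        using K_pair(3)[of x j i] that by (metis cos_minus linorder_neqE_nat minus_diff_eq)
    qed (use K_pair that in auto)
    then show ?thesis
      unfolding potential_def case_prod_beta
      by (intro continuous_intros continuous_on_subset[OF cont]) (auto simp: n_def)
  qed
  ultimately obtain m where m: "m \<in> K" "\<And>y. y \<in> K \<Longrightarrow> potential q m \<le> potential q y"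
    using continuous_attains_inf[of K "potential q"] by auto
  show ?thesis
  proof (rule that)
    \<comment> \<open>At differences 0 and 2 pi the cosine is 1, which \<open>K\<close> excludes; so
      the weak inequalities are strict at \<open>m\<close>.\<close>
    have "m i < m j \<and> m j < m i + 2 * pi" if "i < j" "j < n" for i j
    proof -
      have "m j - m i \<noteq> 0" "m j - m i \<noteq> 2 * pi"
        using K_pair(3)[OF m(1) that] by fastforce+
      then show ?thesis
        using K_pair(1,2)[OF m(1) that] by linarith
    qed
    then show "m \<in> ordered_configs (length q)"
      by (simp add: ordered_configs_def n_def)
    show "m 0 = 0"
      using m(1) by (auto simp: K_def box_def PiE_iff dest: spec[of _ 0])
    fix y assume y: "y \<in> ordered_configs (length q)"
    \<comment> \<open>The rotation of \<open>y\<close> with first entry 0, cut off to 0 from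
      \<open>n\<close> on; the potential sees only differences below \<open>n\<close>.\<close>
    define z where "z i = (if i < n then y i - y 0 else 0)" for i
    have z: "z \<in> ordered_configs n" "z 0 = 0" "\<And>i. i \<ge> n \<Longrightarrow> z i = 0"
      using y by (auto simp: z_def n_def ordered_configs_def)
    have "potential q y = potential q z"
      by (rule potential_cong) (simp add: z_def n_def)
    moreover have "potential q m \<le> potential q z"
    proof (cases "potential q z \<le> M")
      case True
      then show ?thesis using mem_K[OF z] m(2) by blast
    next
      case False
      then show ?thesis using m(2)[OF eK] by (simp add: M_def)
    qed
    ultimately show "potential q m \<le> potential q y" by simp
  qed
qed

text \<open>Finitely many strict inequalities, each continuous in \<open>t\<close>, persist nearby.
  This makes a global minimiser a local one in each coordinate.\<close>

lemma eventually_ordered_configs_update: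
  assumes x: "x \<in> ordered_configs n"
  shows "eventually (\<lambda>t. x(i := t) \<in> ordered_configs n) (nhds (x i))"
proof -
  have "eventually (\<lambda>t. \<forall>p\<in>{(a, b). a < b \<and> b < n}.
      (x(i := t)) (snd p) - (x(i := t)) (fst p) \<in> {0<..<2 * pi}) (nhds (x i))"
  proof (rule eventually_ball_finite)
    show "finite {(a, b). a < b \<and> b < n}"
      by (rule finite_subset[of _ "{..<n} \<times> {..<n}"]) auto
    show "\<forall>p\<in>{(a, b). a < b \<and> b < n}. eventually (\<lambda>t.
      (x(i := t)) (snd p) - (x(i := t)) (fst p) \<in> {0<..<2 * pi}) (nhds (x i))"
    proof
      fix p assume p: "p \<in> {(a, b). a < b \<and> b < n}"
      have coord: "((\<lambda>t. (x(i := t)) a) \<longlongrightarrow> x a) (nhds (x i))" for a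
        by (cases "a = i") (auto simp: filterlim_ident)
      have "((\<lambda>t. (x(i := t)) (snd p) - (x(i := t)) (fst p)) \<longlongrightarrow> x (snd p) - x (fst p)) (nhds (x i))"
        by (intro tendsto_diff coord)
      then show "eventually (\<lambda>t. (x(i := t)) (snd p) - (x(i := t)) (fst p) \<in> {0<..<2 * pi}) (nhds (x i))"
        by (rule topological_tendstoD)
          (use p ordered_configsD[OF x, of "fst p" "snd p"] in auto)
    qed
  qed
  then show ?thesis
    by eventually_elim (fastforce simp: ordered_configs_def)
qed

lemma ordered_configs_equilibrium_exists:
  assumes q: "\<And>i. i < length q \<Longrightarrow> q ! i > 0"
  shows "\<exists>\<theta>. cyclically_ordered \<theta> \<and> in_equilibrium q \<theta>"
proof -
  obtain x where x: "x \<in> ordered_configs (length q)" "x 0 = 0"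
    and min: "\<And>y. y \<in> ordered_configs (length q) \<Longrightarrow> potential q x \<le> potential q y"
    using potential_minimiser[OF q] by blast
  define \<theta> where "\<theta> = map x [0..<length q]"
  \<comment> \<open>With \<open>x 0 = 0\<close> every entry lies in [0, 2 pi), so the list is its
    own list of representatives and is sorted without rotating.\<close>
  have "x i rmod (2 * pi) = x i" if "i < length q" for i
    using that x ordered_configsD[OF x(1), of 0 i] by (cases "i = 0") auto
  then have reps: "angle_reps \<theta> = \<theta>"
    by (auto simp: angle_reps_def \<theta>_def)
  have sorted: "sorted_wrt (<) \<theta>"
    using ordered_configsD(1)[OF x(1)] by (auto simp: \<theta>_def sorted_wrt_iff_nth_less)
  have "cyclically_ordered \<theta>"
    unfolding cyclically_ordered_def reps using sorted by (intro exI[of _ 0]) simp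
  moreover have "in_equilibrium q \<theta>"
    unfolding in_equilibrium_def
  proof (intro conjI allI impI)
    show "length \<theta> = length q" by (simp add: \<theta>_def)
    show "distinct (angle_reps \<theta>)"
      using sorted by (simp add: reps strict_sorted_iff)
    fix i assume i: "i < length q"
    have deriv: "((\<lambda>t. potential q (x(i := t))) has_real_derivative
        4 * of_int (q ! i) * total_force q x i) (at (x i))"
      using cos_lt_one_ordered_configs[OF x(1) i] by (intro has_real_derivative_potential i) force
    obtain d where d: "d > 0" "\<And>t. dist t (x i) < d \<Longrightarrow> x(i := t) \<in> ordered_configs (length q)"
      using eventually_ordered_configs_update[OF x(1), of i] by (auto simp: eventually_nhds_metric)
    have "\<forall>t. \<bar>x i - t\<bar> < d \<longrightarrow> potential q (x(i := x i)) \<le> potential q (x(i := t))"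
      using d(2) min by (auto simp: dist_real_def abs_minus_commute)
    then have "4 * of_int (q ! i) * total_force q x i = 0"
      by (rule DERIV_local_min[OF deriv d(1)])
    with deriv have "((\<lambda>t. potential q (x(i := t))) has_real_derivative 0) (at (x i))"
      by (simp only:)
    then show "((\<lambda>t. cm_potential q (\<theta>[i := t])) has_real_derivative 0) (at (\<theta> ! i))"
      using cm_potential_update[of q \<theta> x i] i by (simp add: \<theta>_def)
  qed
  ultimately show ?thesis by blast
qed

section \<open>Existence and uniqueness on the circle\<close>

theorem theorem5p1:
  fixes q :: "int list"
  assumes "\<forall>x \<in> set q. x > 0"
  shows "(\<exists>\<theta>. cyclically_ordered \<theta> \<and> in_equilibrium q \<theta>) \<and>
    (\<forall>\<theta> \<theta>'. cyclically_ordered \<theta> \<and> in_equilibrium q \<theta> \<and>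
            cyclically_ordered \<theta>' \<and> in_equilibrium q \<theta>' \<longrightarrow>
      (\<exists>c. \<forall>i < length q. [\<theta>' ! i = \<theta> ! i + c] (rmod (2 * pi))))"
proof (intro conjI allI impI)
  have q: "q ! i > 0" if "i < length q" for i
    using assms that by simp
  show "\<exists>\<theta>. cyclically_ordered \<theta> \<and> in_equilibrium q \<theta>"
    using ordered_configs_equilibrium_exists[OF q] .
  fix \<theta> \<theta>'
  assume *: "cyclically_ordered \<theta> \<and> in_equilibrium q \<theta> \<and>
            cyclically_ordered \<theta>' \<and> in_equilibrium q \<theta>'"
  then have len: "length \<theta> = length q" "length \<theta>' = length q"
    by (auto simp: in_equilibrium_def)
  \<comment> \<open>Both equilibria are compared through their lifts, where the rotation is an
    honest real translation; congruence modulo 2 pi carries it back.\<close>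
  obtain x where x: "x \<in> ordered_configs (length q)"
    "\<And>i. i < length q \<Longrightarrow> [x i = \<theta> ! i] (rmod (2 * pi))"
    using * len cyclically_ordered_lift[of \<theta>] by metis
  obtain y where y: "y \<in> ordered_configs (length q)"
    "\<And>i. i < length q \<Longrightarrow> [y i = \<theta>' ! i] (rmod (2 * pi))"
    using * len cyclically_ordered_lift[of \<theta>'] by metis
  have "\<exists>c. \<forall>i < length q. y i = x i + c"
    using * by (intro ordered_configs_equilibrium_unique q x(1) y(1)
        in_equilibrium_imp_total_force_eq_0[OF q _ x]
        in_equilibrium_imp_total_force_eq_0[OF q _ y]) auto
  then obtain c where c: "\<And>i. i < length q \<Longrightarrow> y i = x i + c"
    by blast
  have "[\<theta>' ! i = \<theta> ! i + c] (rmod (2 * pi))" if "i < length q" for i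
  proof -
    have "[\<theta>' ! i = x i + c] (rmod (2 * pi))"
      using y(2)[OF that] c[OF that] by (simp add: rcong_sym)
    also have "[x i + c = \<theta> ! i + c] (rmod (2 * pi))"
      using x(2)[OF that] by simp
    finally show ?thesis .
  qed
  then show "\<exists>c. \<forall>i < length q. [\<theta>' ! i = \<theta> ! i + c] (rmod (2 * pi))"
    by blast
qed

end
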